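(* There exists an absolute constant $c>0$ such that for all sufficiently large $n$, $$D_2(n)\ge c\,n^{1/10}.$$
   Context: A finite set of at least three lines in $\mathbb{R}^2$ is in general position if every two of the lines meet in a single point and no three of them have a common point. Any three lines of such a set determine a triangle, whose vertices are the three pairwise intersection points. $D_2(n)$ denotes the largest integer $t$ such that every set of $n$ lines in general position in $\mathbb{R}^2$ contains a subset of $t$ lines for which all the triangles determined by its three-element subsets have pairwise distinct areas. *)

theory Defs
  imports "HOL-Analysis.Analysis"
begin

definition is_line :: "(real^2) set \<Rightarrow> bool" where
  "is_line l \<longleftrightarrow> affine l \<and> aff_dim l = 1"

definition general_position :: "(real^2) set set \<Rightarrow> bool" where
  "general_position L \<longleftrightarrow>
     finite L \<and> 3 \<le> card L \<and> (\<forall>l\<in>L. is_line l) \<and>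
     (\<forall>l\<in>L. \<forall>m\<in>L. l \<noteq> m \<longrightarrow> (\<exists>p. l \<inter> m = {p})) \<and>
     (\<forall>k\<in>L. \<forall>l\<in>L. \<forall>m\<in>L. k \<noteq> l \<and> k \<noteq> m \<and> l \<noteq> m \<longrightarrow> k \<inter> l \<inter> m = {})"

definition vertices :: "(real^2) set set \<Rightarrow> (real^2) set" where
  "vertices T = {p. \<exists>l\<in>T. \<exists>m\<in>T. l \<noteq> m \<and> p \<in> l \<inter> m}"

definition triangle :: "(real^2) set set \<Rightarrow> (real^2) set" where
  "triangle T = convex hull (vertices T)"

definition area :: "(real^2) set \<Rightarrow> real" where
  "area A = measure lebesgue A"

definition distinct_triangle_areas :: "(real^2) set set \<Rightarrow> bool" where
  "distinct_triangle_areas S \<longleftrightarrow>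
     inj_on (\<lambda>T. area (triangle T)) {T. T \<subseteq> S \<and> card T = 3}"

text \<open>
  The maximum exists for every \<open>n \<ge> 3\<close>: \<open>t = 0\<close> is always admissible, and \<open>t \<le> n\<close>
  because sets of \<open>n\<close> lines in general position exist. For \<open>n < 3\<close> there are no such
  sets, and the value is unspecified.
\<close>

definition D2 :: "nat \<Rightarrow> nat" where
  "D2 n = (GREATEST t. \<forall>L. general_position L \<and> card L = n \<longrightarrow>
             (\<exists>S\<subseteq>L. card S = t \<and> distinct_triangle_areas S))"

end

theory Submission
  imports Defs
begin

text \<open>
  After a shear every line becomes \<open>y = w - u x\<close>; encode it by the point \<open>(u, w)\<close>. Triangles then have
  area \<open>det\<^sup>2 / (2 \<bar>V\<bar>)\<close> with \<open>det\<close> the collinearity determinant of the three points and \<open>V\<close> the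
  Vandermonde product of their abscissae.

  If \<open>S\<close> is a maximal subset of \<open>X\<close> with distinct areas and \<open>t = card S\<close>, every \<open>l \<in> X - S\<close> creates a
  coincidence: \<open>area(l,a,b) = area(c,d,e)\<close> or \<open>area(l,a,b) = area(l,c,d)\<close> with elements of \<open>S\<close>.
  Each of these puts \<open>l\<close> on one of \<open>O(t\<^sup>5)\<close> curves \<open>A(u) w\<^sup>2 + B(u) w + C(u) = 0\<close> of bounded degree, whose
  discriminant has a simple zero at the abscissa of some point of \<open>S\<close>. If no such curve contains more than
  \<open>sqrt n\<close> of the points, then \<open>n = O(t\<^sup>5 sqrt n)\<close> for \<open>X = L\<close>. Otherwise let \<open>X\<close> consist of the points on a
  rich curve at which its discriminant does not vanish. The curves arising from any \<open>S \<subseteq> X\<close> branch where the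
  rich curve does not, so they meet it in boundedly many points, and \<open>sqrt n = O(t\<^sup>5)\<close> again.
\<close>

subsection \<open>Plane curves quadratic in the ordinate\<close>

definition discr :: "real poly \<Rightarrow> real poly \<Rightarrow> real poly \<Rightarrow> real poly" where
  "discr A B C = B\<^sup>2 - smult 4 (A * C)"

definition quad_curve :: "real poly \<Rightarrow> real poly \<Rightarrow> real poly \<Rightarrow> (real \<times> real) set" where
  "quad_curve A B C = {(x, y). poly A x * y\<^sup>2 + poly B x * y + poly C x = 0}"

text \<open>A simple zero of the discriminant is a ramification point of the two-valued function
  y(x). Multiplied by any polynomial that is nonzero at \<open>r\<close>, the discriminant keeps
  this simple zero, so the product is never a square. The polynomials are quantified because the
  point set does not determine them; the degree bound makes all intersection counts uniform.\<close>

definition branches_at :: "real \<Rightarrow> (real \<times> real) set \<Rightarrow> bool" where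
  "branches_at r \<Gamma> \<longleftrightarrow> (\<exists>A B C. degree A \<le> 4 \<and> degree B \<le> 4 \<and> degree C \<le> 4 \<and>
     \<Gamma> = quad_curve A B C \<and> poly (discr A B C) r = 0 \<and> poly (pderiv (discr A B C)) r \<noteq> 0)"

text \<open>At a common root the discriminants are the squares of 2ay + b and 2a'y + b', while the
  left-hand base is minus the product of these two numbers. Leading coefficients may vanish.\<close>

lemma common_root_resultant:
  fixes y :: real
  assumes "a * y\<^sup>2 + b * y + c = 0" "a' * y\<^sup>2 + b' * y + c' = 0"
  shows "(2 * a * c' + 2 * a' * c - b * b')\<^sup>2 = (b\<^sup>2 - 4 * a * c) * (b'\<^sup>2 - 4 * a' * c')"
proof -
  have c: "c = - (a * y\<^sup>2 + b * y)" "c' = - (a' * y\<^sup>2 + b' * y)" using assms by linarith+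
  show ?thesis unfolding c by algebra
qed

lemma degree_mult_bound: "degree p \<le> i \<Longrightarrow> degree q \<le> j \<Longrightarrow> degree (p * q :: real poly) \<le> i + j"
  by (metis add_mono degree_mult_le order_trans)

lemma degree_discr:
  assumes "degree A \<le> 4" "degree B \<le> 4" "degree C \<le> 4"
  shows "degree (discr A B C) \<le> 8"
  unfolding discr_def power2_eq_square
  using degree_mult_bound[OF assms(2) assms(2)] degree_mult_bound[OF assms(1) assms(3)]
  by (intro degree_diff_le) auto

text \<open>A Bezout bound by elimination of the ordinate: the eliminant is nonzero because only one
  of the two curves branches at \<open>r\<close>. Only abscissae are counted, since both curves may
  contain the same vertical line; this suffices for points with distinct abscissae.\<close>

lemma card_common_points:
  assumes \<Gamma>: "branches_at r \<Gamma>"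
    and deg: "degree A \<le> 4" "degree B \<le> 4" "degree C \<le> 4"
    and r: "poly (discr A B C) r \<noteq> 0"
  shows "finite {x. \<exists>y. (x, y) \<in> \<Gamma> \<inter> quad_curve A B C}"
    and "card {x. \<exists>y. (x, y) \<in> \<Gamma> \<inter> quad_curve A B C} \<le> 16"
proof -
  obtain A' B' C' where deg': "degree A' \<le> 4" "degree B' \<le> 4" "degree C' \<le> 4"
    and G: "\<Gamma> = quad_curve A' B' C'"
    and r': "poly (discr A' B' C') r = 0" "poly (pderiv (discr A' B' C')) r \<noteq> 0"
    using \<Gamma> unfolding branches_at_def by blast
  define W where "W = smult 2 (A' * C) + smult 2 (A * C') - B' * B"
  define R where "R = W\<^sup>2 - discr A' B' C' * discr A B C"
  \<comment> \<open>\<open>R\<close> is four times the resultant. If it vanished, the product of the discriminants would be a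
    square, but that product has a simple zero at \<open>r\<close>.\<close>
  have "R \<noteq> 0"
  proof
    assume "R = 0"
    then have eq: "W\<^sup>2 = discr A' B' C' * discr A B C" unfolding R_def by simp
    have "poly (W\<^sup>2) r = 0" unfolding eq using r' by simp
    then have "poly W r = 0" by simp
    then have "poly (pderiv (W\<^sup>2)) r = 0" by (simp add: power2_eq_square pderiv_mult)
    moreover have "poly (pderiv (W\<^sup>2)) r \<noteq> 0" unfolding eq using r r' by (simp add: pderiv_mult)
    ultimately show False by simp
  qed
  have "degree W \<le> 8" unfolding W_def
    using degree_mult_bound[OF deg'(1) deg(3)] degree_mult_bound[OF deg(1) deg'(3)]
      degree_mult_bound[OF deg'(2) deg(2)]
    by (intro degree_diff_le degree_add_le) auto
  then have "degree R \<le> 16" unfolding R_def power2_eq_square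
    using degree_mult_bound[of W 8 W 8] degree_mult_bound[OF degree_discr[OF deg'] degree_discr[OF deg]]
    by (intro degree_diff_le) auto
  have sub: "{x. \<exists>y. (x, y) \<in> \<Gamma> \<inter> quad_curve A B C} \<subseteq> {x. poly R x = 0}"
  proof clarify
    fix x y assume "(x, y) \<in> \<Gamma>" "(x, y) \<in> quad_curve A B C"
    then have "poly A' x * y\<^sup>2 + poly B' x * y + poly C' x = 0" "poly A x * y\<^sup>2 + poly B x * y + poly C x = 0"
      unfolding G quad_curve_def by auto
    from common_root_resultant[OF this] show "poly R x = 0"
      unfolding R_def W_def discr_def by (simp add: mult.assoc)
  qed
  show "finite {x. \<exists>y. (x, y) \<in> \<Gamma> \<inter> quad_curve A B C}"
    using sub poly_roots_finite[OF \<open>R \<noteq> 0\<close>] finite_subset by blast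
  have "card {x. \<exists>y. (x, y) \<in> \<Gamma> \<inter> quad_curve A B C} \<le> card {x. poly R x = 0}"
    using sub poly_roots_finite[OF \<open>R \<noteq> 0\<close>] card_mono by blast
  also have "\<dots> \<le> 16" using card_poly_roots_bound[OF \<open>R \<noteq> 0\<close>] \<open>degree R \<le> 16\<close> by linarith
  finally show "card {x. \<exists>y. (x, y) \<in> \<Gamma> \<inter> quad_curve A B C} \<le> 16" .
qed

text \<open>As a quadratic in y, the equation has discriminant 4pq(\<alpha>l' - \<beta>l)^2. At
  \<open>r\<close> the factor q has a simple zero and the others do not vanish. Both families of
  curves used below have this shape.\<close>

lemma branches_atI:
  assumes deg: "degree p \<le> 2" "degree q \<le> 2" "degree l \<le> 1" "degree l' \<le> 1"
    and r: "poly q r = 0" "poly (pderiv q) r \<noteq> 0" "poly p r \<noteq> 0"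
      "\<alpha> * poly l' r \<noteq> \<beta> * poly l r"
  shows "branches_at r {(x, y). poly p x * (\<alpha> * y + poly l x)\<^sup>2 = poly q x * (\<beta> * y + poly l' x)\<^sup>2}"
proof -
  define A where "A = smult (\<alpha>\<^sup>2) p - smult (\<beta>\<^sup>2) q"
  define B where "B = smult (2 * \<alpha>) (p * l) - smult (2 * \<beta>) (q * l')"
  define C where "C = p * (l * l) - q * (l' * l')"
  have D: "discr A B C = smult 4 (q * (p * (smult \<alpha> l' - smult \<beta> l)\<^sup>2))"
    unfolding A_def B_def C_def discr_def poly_eq_poly_eq_iff[symmetric] fun_eq_iff
    by (simp add: algebra_simps power2_eq_square)
  have "degree A \<le> 4" unfolding A_def using deg by (intro degree_diff_le) auto
  moreover have "degree B \<le> 4" unfolding B_def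
    using degree_mult_bound[OF deg(1,3)] degree_mult_bound[OF deg(2,4)] by (intro degree_diff_le) auto
  moreover have "degree C \<le> 4" unfolding C_def
    using degree_mult_bound[OF deg(1) degree_mult_bound[OF deg(3,3)]]
      degree_mult_bound[OF deg(2) degree_mult_bound[OF deg(4,4)]] by (intro degree_diff_le) auto
  moreover have "{(x, y). poly p x * (\<alpha> * y + poly l x)\<^sup>2 = poly q x * (\<beta> * y + poly l' x)\<^sup>2} = quad_curve A B C"
    unfolding quad_curve_def A_def B_def C_def
    by (auto simp: algebra_simps power2_eq_square)
  moreover have "poly (discr A B C) r = 0" unfolding D using r by simp
  moreover have "poly (pderiv (discr A B C)) r \<noteq> 0" unfolding D pderiv_smult pderiv_mult using r by simp
  ultimately show ?thesis unfolding branches_at_def by blast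
qed

subsection \<open>Greedy selection\<close>

text \<open>The lines in dual coordinates: \<open>inj_u\<close> excludes parallel lines and
  \<open>not_collinear\<close> excludes three concurrent ones. The rest of the selection argument
  uses only these facts and the area formula.\<close>

locale planar_points =
  fixes L :: "'a set" and u w :: "'a \<Rightarrow> real" and ar :: "'a set \<Rightarrow> real"
  assumes finite_L: "finite L"
    and inj_u: "inj_on u L"
    and not_collinear: "\<lbrakk>a \<in> L; b \<in> L; c \<in> L; a \<noteq> b; a \<noteq> c; b \<noteq> c\<rbrakk> \<Longrightarrow>
      w a * (u b - u c) + w b * (u c - u a) + w c * (u a - u b) \<noteq> 0"
    and ar_eq: "\<lbrakk>a \<in> L; b \<in> L; c \<in> L; a \<noteq> b; a \<noteq> c; b \<noteq> c\<rbrakk> \<Longrightarrow>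
      ar {a, b, c} = (w a * (u b - u c) + w b * (u c - u a) + w c * (u a - u b))\<^sup>2 /
        (2 * \<bar>(u a - u b) * (u b - u c) * (u c - u a)\<bar>)"
begin

section \<open>Area curves and their branch points\<close>

definition distinct_areas :: "'a set \<Rightarrow> bool" where
  "distinct_areas S \<longleftrightarrow> inj_on ar {T. T \<subseteq> S \<and> card T = 3}"

definition pt :: "'a \<Rightarrow> real \<times> real" where
  "pt l = (u l, w l)"

text \<open>The part free of y in the collinearity determinant of (x, y), \<open>pt a\<close> and
  \<open>pt b\<close>; the remaining part is \<open>(u a - u b) * y\<close>.\<close>

definition chord :: "'a \<Rightarrow> 'a \<Rightarrow> real poly" where
  "chord a b = [:w a * u b - w b * u a, w b - w a:]"

text \<open>Kept with its sign, to stay polynomial in x; the area formula contains its absolute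
  value.\<close>

definition vandermonde :: "'a \<Rightarrow> 'a \<Rightarrow> real poly" where
  "vandermonde a b = smult (u a - u b) ([:- u a, 1:] * [:- u b, 1:])"

text \<open>The points forming a triangle of area \<open>\<kappa>\<close> with a and b, denominators
  cleared. The sign \<open>s\<close> replaces the absolute value of the Vandermonde product; the
  trivial factors 1 and 0 match the shape of \<open>branches_atI\<close>.\<close>

definition area_curve :: "real \<Rightarrow> real \<Rightarrow> 'a \<Rightarrow> 'a \<Rightarrow> (real \<times> real) set" where
  "area_curve s \<kappa> a b = {(x, y). poly 1 x * ((u a - u b) * y + poly (chord a b) x)\<^sup>2 =
     poly (smult (s * (2 * \<kappa>)) (vandermonde a b)) x * (0 * y + poly 1 x)\<^sup>2}"

text \<open>The two area formulas are equated and cross-multiplied; \<open>s\<close> is the relative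
  sign of the two Vandermonde products.\<close>

definition equal_area_curve :: "real \<Rightarrow> 'a \<Rightarrow> 'a \<Rightarrow> 'a \<Rightarrow> 'a \<Rightarrow> (real \<times> real) set" where
  "equal_area_curve s a b c d =
     {(x, y). poly (vandermonde c d) x * ((u a - u b) * y + poly (chord a b) x)\<^sup>2 =
       poly (smult s (vandermonde a b)) x * ((u c - u d) * y + poly (chord c d) x)\<^sup>2}"

lemma u_eq_iff: "a \<in> L \<Longrightarrow> b \<in> L \<Longrightarrow> u a = u b \<longleftrightarrow> a = b"
  using inj_u by (auto dest: inj_onD)

lemma degree_vandermonde: "degree (vandermonde a b) \<le> 2"
  unfolding vandermonde_def by (simp add: degree_smult_le)

lemma poly_vandermonde: "poly (vandermonde a b) x = (u a - u b) * ((x - u a) * (x - u b))"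
  unfolding vandermonde_def by (simp add: algebra_simps)

lemma pderiv_vandermonde: "poly (pderiv (vandermonde a b)) (u a) = (u a - u b)\<^sup>2"
  unfolding vandermonde_def by (simp add: pderiv_smult pderiv_pCons algebra_simps power2_eq_square)

text \<open>The Vandermonde factor has a simple zero at \<open>u a\<close>, and a nonzero area
  \<open>\<kappa>\<close> keeps it simple.\<close>

lemma branches_at_area_curve:
  assumes "a \<in> L" "b \<in> L" "a \<noteq> b" "\<kappa> \<noteq> 0" "s \<noteq> 0"
  shows "branches_at (u a) (area_curve s \<kappa> a b)"
  unfolding area_curve_def
proof (rule branches_atI)
  show "degree (smult (s * (2 * \<kappa>)) (vandermonde a b)) \<le> 2"
    using degree_smult_le degree_vandermonde order_trans by blast
  show "poly (smult (s * (2 * \<kappa>)) (vandermonde a b)) (u a) = 0" by (simp add: poly_vandermonde)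
  show "poly (pderiv (smult (s * (2 * \<kappa>)) (vandermonde a b))) (u a) \<noteq> 0"
    using assms by (simp add: pderiv_smult pderiv_vandermonde u_eq_iff)
qed (use assms in \<open>simp_all add: chord_def u_eq_iff\<close>)

text \<open>If a were c or d, both Vandermonde factors would vanish at \<open>u a\<close> and the
  zero of the discriminant would be multiple. In contrast, b may coincide with c or d.\<close>

lemma branches_at_equal_area_curve:
  assumes abcd: "a \<in> L" "b \<in> L" "c \<in> L" "d \<in> L" "a \<noteq> b" "c \<noteq> d" "a \<noteq> c" "a \<noteq> d" and "s \<noteq> 0"
  shows "branches_at (u a) (equal_area_curve s a b c d)"
  unfolding equal_area_curve_def
proof (rule branches_atI)
  show "degree (smult s (vandermonde a b)) \<le> 2"
    using degree_smult_le degree_vandermonde order_trans by blast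
  show "degree (vandermonde c d) \<le> 2" by (rule degree_vandermonde)
  show "poly (smult s (vandermonde a b)) (u a) = 0" by (simp add: poly_vandermonde)
  show "poly (pderiv (smult s (vandermonde a b))) (u a) \<noteq> 0"
    using assms by (simp add: pderiv_smult pderiv_vandermonde u_eq_iff)
  show "poly (vandermonde c d) (u a) \<noteq> 0" using assms by (simp add: poly_vandermonde u_eq_iff)
  \<comment> \<open>The chord through a and b passes through \<open>pt a\<close>, so at
    \<open>u a\<close> the expression reduces to a multiple of the collinearity determinant of a, c,
    d.\<close>
  have "(u a - u b) * poly (chord c d) (u a) - (u c - u d) * poly (chord a b) (u a) =
      (u a - u b) * (w a * (u c - u d) + w c * (u d - u a) + w d * (u a - u c))"
    unfolding chord_def by (simp add: algebra_simps)
  also have "\<dots> \<noteq> 0" using not_collinear[of a c d] assms by (simp add: u_eq_iff)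
  finally show "(u a - u b) * poly (chord c d) (u a) \<noteq> (u c - u d) * poly (chord a b) (u a)" by simp
qed (simp_all add: chord_def)

lemma ar_chord:
  assumes "l \<in> L" "a \<in> L" "b \<in> L" "l \<noteq> a" "l \<noteq> b" "a \<noteq> b"
  shows "((u a - u b) * w l + poly (chord a b) (u l))\<^sup>2 = 2 * ar {l, a, b} * \<bar>poly (vandermonde a b) (u l)\<bar>"
    and "poly (vandermonde a b) (u l) \<noteq> 0"
proof -
  have 1: "w l * (u a - u b) + w a * (u b - u l) + w b * (u l - u a) = (u a - u b) * w l + poly (chord a b) (u l)"
    unfolding chord_def by (simp add: algebra_simps)
  have 2: "\<bar>(u l - u a) * (u a - u b) * (u b - u l)\<bar> = \<bar>poly (vandermonde a b) (u l)\<bar>"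
    unfolding poly_vandermonde by (simp add: abs_mult abs_minus_commute algebra_simps)
  show nz: "poly (vandermonde a b) (u l) \<noteq> 0" using assms by (simp add: poly_vandermonde u_eq_iff)
  show "((u a - u b) * w l + poly (chord a b) (u l))\<^sup>2 = 2 * ar {l, a, b} * \<bar>poly (vandermonde a b) (u l)\<bar>"
    using ar_eq[OF assms(1-5)] assms(6) nz unfolding 1 2 by simp
qed

lemma pt_in_area_curve:
  assumes "l \<in> L" "a \<in> L" "b \<in> L" "l \<noteq> a" "l \<noteq> b" "a \<noteq> b"
  shows "\<exists>s\<in>{1, -1}. pt l \<in> area_curve s (ar {l, a, b}) a b"
  using ar_chord(1)[OF assms] unfolding pt_def area_curve_def
  by (cases "poly (vandermonde a b) (u l) \<ge> 0") simp_all

lemma pt_in_equal_area_curve: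
  assumes "l \<in> L" "a \<in> L" "b \<in> L" "l \<noteq> a" "l \<noteq> b" "a \<noteq> b"
    "c \<in> L" "d \<in> L" "l \<noteq> c" "l \<noteq> d" "c \<noteq> d" and eq: "ar {l, a, b} = ar {l, c, d}"
  shows "\<exists>s\<in>{1, -1}. pt l \<in> equal_area_curve s a b c d"
proof -
  define N where "N = poly (vandermonde a b) (u l)"
  define N' where "N' = poly (vandermonde c d) (u l)"
  \<comment> \<open>Both sides have absolute value |N N'|, so they differ at most by a sign.\<close>
  obtain s where s: "s \<in> {1, -1}" "N' * \<bar>N\<bar> = s * N * \<bar>N'\<bar>"
  proof (cases "N' * N \<ge> 0")
    case True
    then have "N' * \<bar>N\<bar> = 1 * N * \<bar>N'\<bar>" by (auto simp: abs_if mult_less_0_iff zero_le_mult_iff)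
    then show ?thesis using that by blast
  next
    case False
    then have "N' * \<bar>N\<bar> = -1 * N * \<bar>N'\<bar>" by (auto simp: abs_if mult_less_0_iff zero_le_mult_iff)
    then show ?thesis using that by blast
  qed
  have "N' * ((u a - u b) * w l + poly (chord a b) (u l))\<^sup>2 =
      s * N * ((u c - u d) * w l + poly (chord c d) (u l))\<^sup>2"
    using ar_chord(1)[OF assms(1-6)] ar_chord(1)[OF assms(1,7-11)] s(2) eq
    unfolding N_def[symmetric] N'_def[symmetric] by simp
  then show ?thesis using s(1) unfolding pt_def equal_area_curve_def N_def N'_def by auto
qed

lemma ar_nonzero:
  assumes "T \<subseteq> L" "card T = 3"
  shows "ar T \<noteq> 0"
proof -
  obtain a b c where "T = {a, b, c}" "a \<noteq> b" "a \<noteq> c" "b \<noteq> c" using assms(2) card_3_iff by metis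
  then show ?thesis using assms(1) not_collinear[of a b c] ar_eq[of a b c] by (auto simp: u_eq_iff)
qed

section \<open>Curves through the elements that block an extension\<close>

lemma triple_with_element:
  assumes "T \<subseteq> insert l S" "card T = 3" "\<not> T \<subseteq> S"
  obtains a b where "T = {l, a, b}" "a \<in> S" "b \<in> S" "a \<noteq> b" "l \<noteq> a" "l \<noteq> b"
proof -
  have "l \<in> T" using assms by blast
  then have "card (T - {l}) = 2" using assms(2) by simp
  then obtain a b where "T - {l} = {a, b}" "a \<noteq> b" by (meson card_2_iff)
  then have "T = {l, a, b}" "a \<in> S" "b \<in> S" "l \<noteq> a" "l \<noteq> b" using assms(1) \<open>l \<in> T\<close> by blast+
  then show ?thesis using that \<open>a \<noteq> b\<close> by blast
qed

text \<open>Two triples of equal area cannot both lie in \<open>S\<close>. If one of them contains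
  l, the other prescribes the area and gives an \<open>area_curve\<close>; if both do, they give an
  \<open>equal_area_curve\<close>.\<close>

lemma blocking_curve:
  assumes S: "S \<subseteq> L" "distinct_areas S" and l: "l \<in> L" "l \<notin> S" "\<not> distinct_areas (insert l S)"
  shows "(\<exists>s\<in>{1, -1}. \<exists>a\<in>S. \<exists>b\<in>S. \<exists>T. a \<noteq> b \<and> T \<subseteq> S \<and> card T = 3 \<and> pt l \<in> area_curve s (ar T) a b) \<or>
    (\<exists>s\<in>{1, -1}. \<exists>a\<in>S. \<exists>b\<in>S. \<exists>c\<in>S. \<exists>d\<in>S. a \<noteq> b \<and> c \<noteq> d \<and> a \<noteq> c \<and> a \<noteq> d \<and>
      pt l \<in> equal_area_curve s a b c d)" (is "?A \<or> ?B")
proof -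
  have A: ?A if T: "T \<subseteq> insert l S" "card T = 3" "\<not> T \<subseteq> S" and T': "T' \<subseteq> S" "card T' = 3"
    and eq: "ar T = ar T'" for T T'
  proof -
    obtain a b where ab: "T = {l, a, b}" "a \<in> S" "b \<in> S" "a \<noteq> b" "l \<noteq> a" "l \<noteq> b"
      using triple_with_element[OF T] by metis
    then show ?A using pt_in_area_curve[of l a b] S(1) l(1) T' eq by (metis subsetD)
  qed
  have B: ?B if T: "T = {l, a, b}" "a \<in> S" "b \<in> S" "a \<noteq> b" "l \<noteq> a" "l \<noteq> b"
    and T': "T' = {l, c, d}" "c \<in> S" "d \<in> S" "c \<noteq> d" "l \<noteq> c" "l \<noteq> d"
    and "a \<noteq> c" "a \<noteq> d" "ar T = ar T'" for T T' a b c d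
    using pt_in_equal_area_curve[of l a b c d] that S(1) l(1) by (metis subsetD)
  obtain T T' where T: "T \<subseteq> insert l S" "card T = 3" "T' \<subseteq> insert l S" "card T' = 3"
    and eq: "ar T = ar T'" and "T \<noteq> T'"
    using l(3) unfolding distinct_areas_def inj_on_def by auto
  consider "T \<subseteq> S" "T' \<subseteq> S" | "\<not> T \<subseteq> S" "T' \<subseteq> S" | "T \<subseteq> S" "\<not> T' \<subseteq> S" | "\<not> T \<subseteq> S" "\<not> T' \<subseteq> S"
    by blast
  then show ?thesis
  proof cases
    case 1
    then show ?thesis using inj_onD[OF S(2)[unfolded distinct_areas_def] eq] T(2,4) \<open>T \<noteq> T'\<close> by simp
  next
    case 2
    then show ?thesis using A[of T T'] T eq by blast
  next
    case 3
    then show ?thesis using A[of T' T] T eq by simp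
  next
    case 4
    obtain a b where ab: "T = {l, a, b}" "a \<in> S" "b \<in> S" "a \<noteq> b" "l \<noteq> a" "l \<noteq> b"
      using triple_with_element[OF T(1,2) 4(1)] by metis
    obtain c d where cd: "T' = {l, c, d}" "c \<in> S" "d \<in> S" "c \<noteq> d" "l \<noteq> c" "l \<noteq> d"
      using triple_with_element[OF T(3,4) 4(2)] by metis
    \<comment> \<open>The curve must branch at a point outside \<open>{c, d}\<close>, which is \<open>a\<close> or \<open>b\<close>.\<close>
    have ba: "T = {l, b, a}" using ab(1) by blast
    consider "a \<noteq> c" "a \<noteq> d" | "b \<noteq> c" "b \<noteq> d" using ab cd \<open>T \<noteq> T'\<close> by blast
    then show ?thesis
    proof cases
      case 1
      then show ?thesis using B[OF ab cd _ _ eq] by blast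
    next
      case 2
      then show ?thesis using B[OF ba ab(3,2) ab(4)[symmetric] ab(6,5) cd _ _ eq] by blast
    qed
  qed
qed

text \<open>With t = \<open>card S\<close> there are at most 2 t^2 t^3 curves of the first kind
  (sign, pair, triple prescribing the area) and 2 t^4 of the second (sign, two pairs).\<close>

lemma blocking_curves:
  assumes S: "S \<subseteq> L" "distinct_areas S" "S \<noteq> {}"
  shows "\<exists>\<C>. finite \<C> \<and> card \<C> \<le> 4 * card S ^ 5 \<and>
    (\<forall>\<Gamma>\<in>\<C>. \<exists>a\<in>S. branches_at (u a) \<Gamma>) \<and>
    (\<forall>l\<in>L - S. \<not> distinct_areas (insert l S) \<longrightarrow> (\<exists>\<Gamma>\<in>\<C>. pt l \<in> \<Gamma>))"
proof -
  have "finite S" using S(1) finite_L finite_subset by blast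
  define I where "I = {1, -1 :: real} \<times> {(a, b). a \<in> S \<and> b \<in> S \<and> a \<noteq> b} \<times> {T. T \<subseteq> S \<and> card T = 3}"
  define J where "J = {1, -1 :: real} \<times> {(a, b, c, d). a \<in> S \<and> b \<in> S \<and> c \<in> S \<and> d \<in> S \<and>
    a \<noteq> b \<and> c \<noteq> d \<and> a \<noteq> c \<and> a \<noteq> d}"
  define F where "F = (\<lambda>(s, (a, b), T). area_curve s (ar T) a b)"
  define G where "G = (\<lambda>(s, a, b, c, d). equal_area_curve s a b c d)"
  have two: "card {1, -1 :: real} = 2" by simp
  have sub2: "{(a, b). a \<in> S \<and> b \<in> S \<and> a \<noteq> b} \<subseteq> S \<times> S" by auto
  have sub4: "{(a, b, c, d). a \<in> S \<and> b \<in> S \<and> c \<in> S \<and> d \<in> S \<and> a \<noteq> b \<and> c \<noteq> d \<and> a \<noteq> c \<and> a \<noteq> d}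
      \<subseteq> S \<times> S \<times> S \<times> S" by auto
  have fin: "finite I" "finite J" unfolding I_def J_def
    using \<open>finite S\<close> finite_subset[OF sub2] finite_subset[OF sub4] by auto
  have "card {(a, b). a \<in> S \<and> b \<in> S \<and> a \<noteq> b} \<le> card (S \<times> S)"
    using \<open>finite S\<close> sub2 by (intro card_mono) auto
  then have c2: "card {(a, b). a \<in> S \<and> b \<in> S \<and> a \<noteq> b} \<le> card S ^ 2"
    by (simp add: card_cartesian_product power2_eq_square)
  \<comment> \<open>The power bound on binomials covers \<open>card S\<close> at least 3; below that
    the binomial is 0.\<close>
  have c3: "card {T. T \<subseteq> S \<and> card T = 3} \<le> card S ^ 3"
    unfolding n_subsets[OF \<open>finite S\<close>]
    using binomial_le_pow[of 3 "card S"] binomial_eq_0[of "card S" 3] by (metis not_le zero_le)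
  have "card {(a, b, c, d). a \<in> S \<and> b \<in> S \<and> c \<in> S \<and> d \<in> S \<and> a \<noteq> b \<and> c \<noteq> d \<and> a \<noteq> c \<and> a \<noteq> d}
      \<le> card (S \<times> S \<times> S \<times> S)"
    using \<open>finite S\<close> sub4 by (intro card_mono) auto
  then have c4: "card J \<le> 2 * card S ^ 4"
    unfolding J_def card_cartesian_product two by (simp add: card_cartesian_product power4_eq_xxxx mult.assoc)
  have "card I \<le> 2 * (card S ^ 2 * card S ^ 3)"
    unfolding I_def card_cartesian_product two using mult_le_mono[OF c2 c3] by simp
  also have "card S ^ 2 * card S ^ 3 = card S ^ 5" by (simp flip: power_add)
  finally have c5: "card I \<le> 2 * card S ^ 5" .
  have "card S ^ 4 \<le> card S ^ 5"
    using S(3) \<open>finite S\<close> by (intro power_increasing) (auto simp: Suc_le_eq card_gt_0_iff)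
  moreover have "card (F ` I \<union> G ` J) \<le> card I + card J"
    using card_Un_le[of "F ` I" "G ` J"] card_image_le[OF fin(1), of F] card_image_le[OF fin(2), of G]
    by linarith
  ultimately have card: "card (F ` I \<union> G ` J) \<le> 4 * card S ^ 5" using c4 c5 by linarith
  have branches: "\<exists>a\<in>S. branches_at (u a) \<Gamma>" if "\<Gamma> \<in> F ` I \<union> G ` J" for \<Gamma>
    using that
  proof
    assume "\<Gamma> \<in> F ` I"
    then obtain s a b T where "\<Gamma> = area_curve s (ar T) a b" "s \<in> {1, -1}" "a \<in> S" "b \<in> S" "a \<noteq> b"
      "T \<subseteq> S" "card T = 3"
      unfolding F_def I_def by auto
    moreover from this have "ar T \<noteq> 0" "a \<in> L" "b \<in> L" "s \<noteq> 0" using ar_nonzero[of T] S(1) by auto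
    ultimately show ?thesis using branches_at_area_curve by blast
  next
    assume "\<Gamma> \<in> G ` J"
    then obtain s a b c d where "\<Gamma> = equal_area_curve s a b c d" "s \<in> {1, -1}"
      "a \<in> S" "b \<in> S" "c \<in> S" "d \<in> S" "a \<noteq> b" "c \<noteq> d" "a \<noteq> c" "a \<noteq> d"
      unfolding G_def J_def by auto
    moreover from this have "a \<in> L" "b \<in> L" "c \<in> L" "d \<in> L" "s \<noteq> 0" using S(1) by auto
    ultimately show ?thesis using branches_at_equal_area_curve by blast
  qed
  have cover: "\<exists>\<Gamma>\<in>F ` I \<union> G ` J. pt l \<in> \<Gamma>" if "l \<in> L - S" "\<not> distinct_areas (insert l S)" for l
  proof -
    have "l \<in> L" "l \<notin> S" using that(1) by auto
    from blocking_curve[OF S(1,2) this that(2)] show ?thesis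
    proof (elim disjE)
      assume "\<exists>s\<in>{1, -1}. \<exists>a\<in>S. \<exists>b\<in>S. \<exists>T. a \<noteq> b \<and> T \<subseteq> S \<and> card T = 3 \<and> pt l \<in> area_curve s (ar T) a b"
      then obtain s a b T where "pt l \<in> F (s, (a, b), T)" "(s, (a, b), T) \<in> I"
        unfolding F_def I_def mem_Times_iff mem_Collect_eq prod.case fst_conv snd_conv by blast
      then show ?thesis by blast
    next
      assume "\<exists>s\<in>{1, -1}. \<exists>a\<in>S. \<exists>b\<in>S. \<exists>c\<in>S. \<exists>d\<in>S. a \<noteq> b \<and> c \<noteq> d \<and> a \<noteq> c \<and> a \<noteq> d \<and>
        pt l \<in> equal_area_curve s a b c d"
      then obtain s a b c d where "pt l \<in> G (s, a, b, c, d)" "(s, a, b, c, d) \<in> J"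
        unfolding G_def J_def mem_Times_iff mem_Collect_eq prod.case fst_conv snd_conv by blast
      then show ?thesis by blast
    qed
  qed
  show ?thesis
  proof (intro exI conjI ballI impI)
    show "finite (F ` I \<union> G ` J)" using fin by simp
  qed (rule card, erule branches, erule (1) cover)
qed

text \<open>The bound is required only for curves branching at points of \<open>X\<close>, which
  suffices because \<open>S\<close> is chosen inside \<open>X\<close>. This form serves both
  \<open>L\<close> itself and the points of one rich curve.\<close>

lemma greedy:
  assumes X: "X \<subseteq> L" "X \<noteq> {}" and M: "M \<ge> 1"
    and bound: "\<And>a \<Gamma>. a \<in> X \<Longrightarrow> branches_at (u a) \<Gamma> \<Longrightarrow> real (card {l \<in> X. pt l \<in> \<Gamma>}) \<le> M"
  obtains S where "S \<subseteq> X" "distinct_areas S" "real (card X) \<le> 5 * real (card S) ^ 5 * M"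
proof -
  have "finite X" using X(1) finite_L finite_subset by blast
  obtain x where "x \<in> X" using X(2) by blast
  \<comment> \<open>A singleton has no triples; starting from it ensures that the maximal set is
    nonempty.\<close>
  have "\<not> (T \<subseteq> {x} \<and> card T = 3)" for T
    using card_mono[of "{x}" T] by auto
  then have "distinct_areas {x}" unfolding distinct_areas_def inj_on_def by blast
  then have "finite {S. S \<subseteq> X \<and> distinct_areas S}" "{x} \<in> {S. S \<subseteq> X \<and> distinct_areas S}"
    using \<open>finite X\<close> \<open>x \<in> X\<close> by auto
  then obtain S where S: "S \<subseteq> X" "distinct_areas S" "{x} \<subseteq> S"
    and max: "\<And>R. R \<subseteq> X \<Longrightarrow> distinct_areas R \<Longrightarrow> S \<subseteq> R \<Longrightarrow> S = R"
    using finite_has_maximal2[of "{S. S \<subseteq> X \<and> distinct_areas S}" "{x}"] by auto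
  have "finite S" "S \<noteq> {}" using S \<open>finite X\<close> finite_subset by auto
  obtain \<C> where \<C>: "finite \<C>" "card \<C> \<le> 4 * card S ^ 5"
    "\<And>\<Gamma>. \<Gamma> \<in> \<C> \<Longrightarrow> \<exists>a\<in>S. branches_at (u a) \<Gamma>"
    "\<And>l. l \<in> L - S \<Longrightarrow> \<not> distinct_areas (insert l S) \<Longrightarrow> \<exists>\<Gamma>\<in>\<C>. pt l \<in> \<Gamma>"
    using blocking_curves[OF order_trans[OF S(1) X(1)] S(2) \<open>S \<noteq> {}\<close>] by blast
  have "X \<subseteq> S \<union> (\<Union>\<Gamma>\<in>\<C>. {l \<in> X. pt l \<in> \<Gamma>})"
  proof
    fix l assume "l \<in> X"
    show "l \<in> S \<union> (\<Union>\<Gamma>\<in>\<C>. {l \<in> X. pt l \<in> \<Gamma>})"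
    proof (cases "l \<in> S")
      case False
      then have "\<not> distinct_areas (insert l S)" using max[of "insert l S"] \<open>l \<in> X\<close> S(1) by blast
      then show ?thesis using \<C>(4)[of l] \<open>l \<in> X\<close> X(1) False by blast
    qed simp
  qed
  then have "card X \<le> card (S \<union> (\<Union>\<Gamma>\<in>\<C>. {l \<in> X. pt l \<in> \<Gamma>}))"
    using \<open>finite S\<close> \<open>finite X\<close> \<C>(1) by (intro card_mono) auto
  also have "\<dots> \<le> card S + (\<Sum>\<Gamma>\<in>\<C>. card {l \<in> X. pt l \<in> \<Gamma>})"
    using card_Un_le[of S] card_UN_le[OF \<C>(1), of "\<lambda>\<Gamma>. {l \<in> X. pt l \<in> \<Gamma>}"]
    by (meson add_left_mono order_trans)
  finally have "real (card X) \<le> real (card S + (\<Sum>\<Gamma>\<in>\<C>. card {l \<in> X. pt l \<in> \<Gamma>}))"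
    by (rule of_nat_mono)
  also have "\<dots> = real (card S) + (\<Sum>\<Gamma>\<in>\<C>. real (card {l \<in> X. pt l \<in> \<Gamma>}))" by simp
  also have "\<dots> \<le> real (card S) + (\<Sum>\<Gamma>\<in>\<C>. M)"
  proof (intro add_left_mono sum_mono)
    fix \<Gamma> assume "\<Gamma> \<in> \<C>"
    then obtain a where "a \<in> X" "branches_at (u a) \<Gamma>" using \<C>(3) S(1) by blast
    then show "real (card {l \<in> X. pt l \<in> \<Gamma>}) \<le> M" by (rule bound)
  qed
  \<comment> \<open>The elements of \<open>S\<close> itself are absorbed into one more term t^5 M,
    as t and M are at least 1.\<close>
  also have "\<dots> \<le> real (card S) ^ 5 * M + 4 * real (card S) ^ 5 * M"
  proof (rule add_mono)
    have "card S \<ge> 1" using \<open>finite S\<close> \<open>S \<noteq> {}\<close> by (simp add: Suc_le_eq card_gt_0_iff)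
    then have "real (card S) * 1 \<le> real (card S) ^ 5 * M"
      using M by (intro mult_mono self_le_power) auto
    then show "real (card S) \<le> real (card S) ^ 5 * M" by simp
    have "real (card \<C>) \<le> real (4 * card S ^ 5)" using \<C>(2) of_nat_le_iff by blast
    then show "(\<Sum>\<Gamma>\<in>\<C>. M) \<le> 4 * real (card S) ^ 5 * M" using M by simp
  qed
  finally have "real (card X) \<le> 5 * real (card S) ^ 5 * M" by (simp add: algebra_simps)
  then show ?thesis by (rule that[OF S(1,2)])
qed

lemma large_distinct_areas:
  assumes n: "card L \<ge> 256"
  obtains S where "S \<subseteq> L" "distinct_areas S" "sqrt (card L) \<le> 160 * real (card S) ^ 5"
proof -
  define n where "n = real (card L)"
  have sqrt_n: "sqrt n \<ge> 16" unfolding n_def using n by (intro real_le_rsqrt) simp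
  then have "sqrt n * sqrt n = n" "n > 0" using n unfolding n_def by auto
  show ?thesis
  proof (cases "\<forall>a\<in>L. \<forall>\<Gamma>. branches_at (u a) \<Gamma> \<longrightarrow> real (card {l \<in> L. pt l \<in> \<Gamma>}) \<le> sqrt n")
    case True
    then obtain S where S: "S \<subseteq> L" "distinct_areas S" "n \<le> 5 * real (card S) ^ 5 * sqrt n"
      using greedy[of L "sqrt n"] sqrt_n n unfolding n_def by force
    have "sqrt n * sqrt n \<le> (5 * real (card S) ^ 5) * sqrt n" using S(3) \<open>sqrt n * sqrt n = n\<close> by linarith
    moreover have "sqrt n > 0" using sqrt_n by linarith
    ultimately have "sqrt n \<le> 5 * real (card S) ^ 5" by (rule mult_right_le_imp_le)
    then show ?thesis using that[of S] S(1,2) unfolding n_def by (smt (verit) zero_le_power of_nat_0_le_iff)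
  next
    case False
    then obtain r \<Gamma> where \<Gamma>: "branches_at r \<Gamma>" and many: "real (card {l \<in> L. pt l \<in> \<Gamma>}) > sqrt n"
      by (auto simp: not_le)
    obtain A B C where deg: "degree A \<le> 4" "degree B \<le> 4" "degree C \<le> 4"
      and G: "\<Gamma> = quad_curve A B C" and r: "poly (pderiv (discr A B C)) r \<noteq> 0"
      using \<Gamma> unfolding branches_at_def by blast
    \<comment> \<open>Discarding at most eight points of the rich curve leaves abscissae where it
      does not branch, as \<open>card_common_points\<close> demands of its second curve.\<close>
    define Z where "Z = {x. poly (discr A B C) x = 0}"
    define X where "X = {l \<in> L. pt l \<in> \<Gamma> \<and> u l \<notin> Z}"
    have "discr A B C \<noteq> 0" using r by auto
    then have Z: "finite Z" "card Z \<le> 8"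
      unfolding Z_def using poly_roots_finite card_poly_roots_bound degree_discr[OF deg] by (auto intro: order_trans)
    have "card {l \<in> L. u l \<in> Z} \<le> card Z"
      using Z inj_u by (intro card_inj_on_le[where f = u]) (auto simp: inj_on_def)
    moreover have "card {l \<in> L. pt l \<in> \<Gamma>} \<le> card X + card {l \<in> L. u l \<in> Z}"
      using finite_L unfolding X_def
      by (intro order_trans[OF card_mono card_Un_le]) auto
    ultimately have cX: "real (card X) \<ge> sqrt n - 8" using many Z(2) by linarith
    then have "X \<noteq> {}" using sqrt_n by auto
    have "real (card {l \<in> X. pt l \<in> \<Delta>}) \<le> 16" if a: "a \<in> X" "branches_at (u a) \<Delta>" for a \<Delta>
    proof -
      have nz: "poly (discr A B C) (u a) \<noteq> 0" using a(1) unfolding X_def Z_def by simp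
      have "card {l \<in> X. pt l \<in> \<Delta>} \<le> card {x. \<exists>y. (x, y) \<in> \<Delta> \<inter> quad_curve A B C}"
      proof (rule card_inj_on_le)
        show "inj_on u {l \<in> X. pt l \<in> \<Delta>}" using inj_u unfolding X_def by (auto simp: inj_on_def)
        show "u ` {l \<in> X. pt l \<in> \<Delta>} \<subseteq> {x. \<exists>y. (x, y) \<in> \<Delta> \<inter> quad_curve A B C}"
          unfolding X_def G pt_def by blast
      qed (rule card_common_points(1)[OF a(2) deg nz])
      then show ?thesis using card_common_points(2)[OF a(2) deg nz] by linarith
    qed
    then obtain S where S: "S \<subseteq> X" "distinct_areas S" "real (card X) \<le> 5 * real (card S) ^ 5 * 16"
      using greedy[of X 16] \<open>X \<noteq> {}\<close> unfolding X_def by auto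
    have "S \<subseteq> L" using S(1) unfolding X_def by blast
    \<comment> \<open>Since sqrt n is at least 16, \<open>card X\<close> is at least half of sqrt n;
      the greedy bound is 80 t^5.\<close>
    moreover have "sqrt n \<le> 160 * real (card S) ^ 5" using S(3) cX sqrt_n by linarith
    ultimately show ?thesis using that S(2) unfolding n_def by blast
  qed
qed

end

subsection \<open>Lines as points\<close>

lemma is_line_iff:
  "is_line l \<longleftrightarrow> (\<exists>p q r. (p \<noteq> 0 \<or> q \<noteq> 0) \<and> l = {z. p * z $ 1 + q * z $ 2 = r})"
proof
  assume "is_line l"
  then have "aff_dim l = DIM(real^2) - 1" "affine hull l = l"
    unfolding is_line_def by (simp_all add: affine_hull_eq)
  then obtain a :: "real^2" and b where "a \<noteq> 0" "l = {z. a \<bullet> z = b}" unfolding aff_dim_eq_hyperplane by auto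
  then show "\<exists>p q r. (p \<noteq> 0 \<or> q \<noteq> 0) \<and> l = {z. p * z $ 1 + q * z $ 2 = r}"
    by (intro exI[of _ "a $ 1"] exI[of _ "a $ 2"] exI[of _ b]) (auto simp: inner_vec_def vec_eq_iff sum_2 forall_2)
next
  assume "\<exists>p q r. (p \<noteq> 0 \<or> q \<noteq> 0) \<and> l = {z. p * z $ 1 + q * z $ 2 = r}"
  then obtain p q r where pq: "p \<noteq> 0 \<or> q \<noteq> 0" "l = {z. p * z $ 1 + q * z $ 2 = r}" by blast
  define a :: "real^2" where "a = vector [p, q]"
  have "a \<noteq> 0" "l = {z. a \<bullet> z = r}" using pq
    unfolding a_def by (auto simp: inner_vec_def vec_eq_iff sum_2 forall_2)
  then show "is_line l" unfolding is_line_def by (simp add: affine_hyperplane)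
qed

text \<open>The shear \<open>(x, y) \<mapsto> (x - s y, y)\<close> preserves area and maps the line below to \<open>y = w - u x\<close>.\<close>
definition sheared_line :: "real \<Rightarrow> real \<Rightarrow> real \<Rightarrow> (real^2) set" where
  "sheared_line s u w = {z. u * z $ 1 + (1 - s * u) * z $ 2 = w}"

text \<open>Each line becomes vertical for at most one value of \<open>s\<close>, so finitely many
  values are excluded.\<close>

lemma common_shear:
  assumes "finite L" "\<And>l. l \<in> L \<Longrightarrow> is_line l"
  obtains s u w where "\<forall>l\<in>L. sheared_line s (u l) (w l) = l"
proof -
  have "\<forall>l\<in>L. \<exists>a. (fst a \<noteq> 0 \<or> fst (snd a) \<noteq> 0) \<and> {z. fst a * z $ 1 + fst (snd a) * z $ 2 = snd (snd a)} = l"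
    using assms(2) unfolding is_line_iff by fastforce
  then obtain f where f: "\<forall>l\<in>L. (fst (f l) \<noteq> 0 \<or> fst (snd (f l)) \<noteq> 0) \<and>
      {z. fst (f l) * z $ 1 + fst (snd (f l)) * z $ 2 = snd (snd (f l))} = l"
    by (rule bchoice[THEN exE])
  define p q r where "p l = fst (f l)" and "q l = fst (snd (f l))" and "r l = snd (snd (f l))" for l
  have pqr: "(p l \<noteq> 0 \<or> q l \<noteq> 0) \<and> {z. p l * z $ 1 + q l * z $ 2 = r l} = l" if "l \<in> L" for l
    using f that unfolding p_def q_def r_def by blast
  have "finite {s. q l + s * p l = 0}" if "l \<in> L" for l
  proof (cases "p l = 0")
    case False
    then have "{s. q l + s * p l = 0} \<subseteq> {- q l / p l}" by (auto simp: field_simps)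
    then show ?thesis using finite_subset by blast
  qed (use pqr[OF that] in auto)
  then have "finite (\<Union>l\<in>L. {s. q l + s * p l = 0})" using assms(1) by blast
  then obtain s where "s \<notin> (\<Union>l\<in>L. {s. q l + s * p l = 0})"
    using ex_new_if_finite infinite_UNIV_char_0 by blast
  then have s: "q l + s * p l \<noteq> 0" if "l \<in> L" for l using that by blast
  show ?thesis
  proof (rule that, rule ballI)
    fix l assume l: "l \<in> L"
    \<comment> \<open>The coefficient of the ordinate after the shear; dividing by it normalises the
      equation.\<close>
    define k where "k = q l + s * p l"
    have "k \<noteq> 0" using s[OF l] k_def by simp
    have "p l / k * z $ 1 + (1 - s * (p l / k)) * z $ 2 = r l / k \<longleftrightarrow> p l * z $ 1 + q l * z $ 2 = r l"
      for z :: "real^2"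
    proof -
      have "p l / k * z $ 1 + (1 - s * (p l / k)) * z $ 2 = (p l * z $ 1 + (k - s * p l) * z $ 2) / k"
        using \<open>k \<noteq> 0\<close> by (simp add: field_simps)
      also have "k - s * p l = q l" unfolding k_def by simp
      finally show ?thesis using \<open>k \<noteq> 0\<close> by (simp add: field_simps)
    qed
    then show "sheared_line s (p l / (q l + s * p l)) (r l / (q l + s * p l)) = l"
      using pqr[OF l] unfolding sheared_line_def k_def by simp
  qed
qed

section \<open>Triangle areas in line coordinates\<close>

lemma area_triangle:
  "area (convex hull {A, B, C}) =
     \<bar>(C $ 1 - A $ 1) * (B $ 2 - A $ 2) - (B $ 1 - A $ 1) * (C $ 2 - A $ 2)\<bar> / 2"
proof -
  have "compact (convex hull {A, B, C})" by (intro compact_convex_hull finite_imp_compact) simp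
  then have "convex hull {A, B, C} \<in> sets lborel" by (simp add: borel_compact)
  then show ?thesis unfolding area_def content_triangle[symmetric] by simp
qed

text \<open>Here x and y are the coordinates after the shear; \<open>x + s * y\<close> undoes
  it.\<close>

definition meet :: "real \<Rightarrow> real \<Rightarrow> real \<Rightarrow> real \<Rightarrow> real \<Rightarrow> real^2" where
  "meet s u w u' w' = (let x = (w - w') / (u - u'); y = w - u * x in vector [x + s * y, y])"

lemma sheared_line_Int:
  assumes "u \<noteq> u'"
  shows "sheared_line s u w \<inter> sheared_line s u' w' = {meet s u w u' w'}"
proof -
  have "u * z $ 1 + (1 - s * u) * z $ 2 = w \<and> u' * z $ 1 + (1 - s * u') * z $ 2 = w' \<longleftrightarrow>
      z $ 1 - s * z $ 2 = (w - w') / (u - u') \<and> z $ 2 = w - u * ((w - w') / (u - u'))" (is "?l \<longleftrightarrow> ?r") for z :: "real^2"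
  proof
    assume l: ?l
    then have "(u - u') * (z $ 1 - s * z $ 2) = w - w'" by (auto simp: algebra_simps)
    then have "z $ 1 - s * z $ 2 = (w - w') / (u - u')" using assms by (simp add: field_simps)
    moreover have "z $ 2 = w - u * (z $ 1 - s * z $ 2)" using l by (auto simp: algebra_simps)
    ultimately show ?r by simp
  next
    assume r: ?r
    define x where "x = (w - w') / (u - u')"
    have "(u - u') * x = w - w'" unfolding x_def using assms by simp
    moreover have "z $ 1 = x + s * (w - u * x)" "z $ 2 = w - u * x" using r unfolding x_def by auto
    ultimately show ?l by (auto simp: algebra_simps)
  qed
  moreover have "z $ 1 - s * z $ 2 = x \<and> z $ 2 = y \<longleftrightarrow> z = vector [x + s * y, y]" for z :: "real^2" and x y
    by (auto simp: vec_eq_iff forall_2)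
  ultimately show ?thesis
    unfolding sheared_line_def meet_def Let_def Collect_conj_eq[symmetric] by simp
qed

text \<open>With x, y, z the sheared abscissae of the vertices, twice the area is |(u1 - u2)(x -
  y)(z - x)|, because two sides leave the first vertex along lines of slopes -u1 and -u2. Each
  difference is the determinant D over a product of slope differences, up to sign.\<close>

lemma triangle_area_eq:
  assumes u: "u1 \<noteq> u2" "u1 \<noteq> u3" "u2 \<noteq> (u3 :: real)"
  shows "area (convex hull {meet s u1 w1 u2 w2, meet s u1 w1 u3 w3, meet s u2 w2 u3 w3}) =
    (w1 * (u2 - u3) + w2 * (u3 - u1) + w3 * (u1 - u2))\<^sup>2 / (2 * \<bar>(u1 - u2) * (u2 - u3) * (u3 - u1)\<bar>)"
proof -
  define x y z where "x = (w1 - w2) / (u1 - u2)" and "y = (w1 - w3) / (u1 - u3)"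
    and "z = (w2 - w3) / (u2 - u3)"
  define D where "D = w1 * (u2 - u3) + w2 * (u3 - u1) + w3 * (u1 - u2)"
  have "w2 = w1 - (u1 - u2) * x" unfolding x_def using u by (simp add: field_simps)
  then have "((z + s * (w2 - u2 * z)) - (x + s * (w1 - u1 * x))) * ((w1 - u1 * y) - (w1 - u1 * x)) -
      ((y + s * (w1 - u1 * y)) - (x + s * (w1 - u1 * x))) * ((w2 - u2 * z) - (w1 - u1 * x))
    = (u1 - u2) * ((x - y) * (z - x))" by algebra
  also have "x - y = D / ((u1 - u2) * (u1 - u3))"
    unfolding x_def y_def D_def using u by (simp add: field_simps)
  also have "z - x = - D / ((u2 - u3) * (u1 - u2))"
  proof -
    have "(u2 - u3) * z = w2 - w3" "(u1 - u2) * x = w1 - w2" unfolding z_def x_def using u by simp_all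
    then have "(z - x) * ((u2 - u3) * (u1 - u2)) = - D" unfolding D_def by algebra
    then show ?thesis by (subst nonzero_eq_divide_eq) (use u in simp_all)
  qed
  also have "(u1 - u2) * (D / ((u1 - u2) * (u1 - u3)) * (- D / ((u2 - u3) * (u1 - u2)))) =
      D\<^sup>2 / ((u1 - u2) * (u2 - u3) * (u3 - u1))"
  proof -
    have "a * (D / (a * e) * (- D / (b * a))) = D\<^sup>2 / (a * b * c)"
      if "a \<noteq> 0" "b \<noteq> 0" "c \<noteq> 0" "e = - c" for a b c e
      using that(1-3) unfolding that(4) by (simp add: field_simps power2_eq_square)
    then show ?thesis by this (use u in simp_all)
  qed
  finally show ?thesis
    unfolding area_triangle meet_def Let_def x_def[symmetric] y_def[symmetric] z_def[symmetric] D_def[symmetric]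
    by (simp add: abs_mult)
qed

lemma vertices_triple:
  assumes "a \<noteq> b" "a \<noteq> c" "b \<noteq> c"
  shows "vertices {a, b, c} = (a \<inter> b) \<union> (a \<inter> c) \<union> (b \<inter> c)"
proof (rule set_eqI)
  fix p
  show "p \<in> vertices {a, b, c} \<longleftrightarrow> p \<in> (a \<inter> b) \<union> (a \<inter> c) \<union> (b \<inter> c)"
    unfolding vertices_def using assms by (simp only: mem_Collect_eq bex_simps Un_iff Int_iff) blast
qed

lemma general_positionD:
  assumes "general_position L"
  shows "finite L" and "l \<in> L \<Longrightarrow> is_line l"
    and "l \<in> L \<Longrightarrow> m \<in> L \<Longrightarrow> l \<noteq> m \<Longrightarrow> \<exists>p. l \<inter> m = {p}"
    and "k \<in> L \<Longrightarrow> l \<in> L \<Longrightarrow> m \<in> L \<Longrightarrow> k \<noteq> l \<Longrightarrow> k \<noteq> m \<Longrightarrow> l \<noteq> m \<Longrightarrow> k \<inter> l \<inter> m = {}"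
  using assms unfolding general_position_def by simp_all

text \<open>Two lines with the same \<open>u\<close> and a common point coincide, and a vanishing
  determinant puts the intersection of two lines on the third.\<close>

lemma planar_points_lines:
  assumes L: "general_position L"
    and lines: "\<And>l. l \<in> L \<Longrightarrow> sheared_line s (u l) (w l) = l"
  shows "planar_points L u w (\<lambda>T. area (triangle T))"
proof
  show "finite L" using L by (rule general_positionD)
  have u: "u l \<noteq> u m" if lm: "l \<in> L" "m \<in> L" "l \<noteq> m" for l m
  proof
    assume "u l = u m"
    obtain p where "l \<inter> m = {p}" using general_positionD(3)[OF L lm] by blast
    then have "p \<in> sheared_line s (u l) (w l)" "p \<in> sheared_line s (u l) (w m)"
      using lines[OF lm(1)] lines[OF lm(2)] \<open>u l = u m\<close> by auto
    then have "w l = w m" unfolding sheared_line_def by simp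
    then show False using lines[OF lm(1)] lines[OF lm(2)] lm(3) \<open>u l = u m\<close> by simp
  qed
  then show "inj_on u L" by (meson inj_onI)
  have Int: "l \<inter> m = {meet s (u l) (w l) (u m) (w m)}" if "l \<in> L" "m \<in> L" "l \<noteq> m" for l m
    using sheared_line_Int[OF u[OF that], of s "w l" "w m"] lines[OF that(1)] lines[OF that(2)] by simp
  fix a b c assume abc: "a \<in> L" "b \<in> L" "c \<in> L" "a \<noteq> b" "a \<noteq> c" "b \<noteq> c"
  have "triangle {a, b, c} = convex hull {meet s (u a) (w a) (u b) (w b),
      meet s (u a) (w a) (u c) (w c), meet s (u b) (w b) (u c) (w c)}"
    unfolding triangle_def vertices_triple[OF abc(4-6)] using Int abc by (simp add: insert_commute)
  then show "area (triangle {a, b, c}) =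
      (w a * (u b - u c) + w b * (u c - u a) + w c * (u a - u b))\<^sup>2 /
        (2 * \<bar>(u a - u b) * (u b - u c) * (u c - u a)\<bar>)"
    using triangle_area_eq u abc by simp
  show "w a * (u b - u c) + w b * (u c - u a) + w c * (u a - u b) \<noteq> 0"
  proof
    assume 0: "w a * (u b - u c) + w b * (u c - u a) + w c * (u a - u b) = 0"
    have ne: "u a - u b \<noteq> 0" using u abc by simp
    define x where "x = (w a - w b) / (u a - u b)"
    define y where "y = w a - u a * x"
    have x: "(u a - u b) * x = w a - w b" unfolding x_def using ne by simp
    have "(u a - u b) * (y - (w c - u c * x)) = 0" unfolding y_def using x 0 by algebra
    then have "w c - u c * x = y" using ne by simp
    then have "meet s (u a) (w a) (u b) (w b) \<in> sheared_line s (u c) (w c)"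
      unfolding meet_def Let_def x_def[symmetric] y_def[symmetric] sheared_line_def
      by (simp add: algebra_simps)
    then have "a \<inter> b \<inter> c \<noteq> {}" using Int[of a b] abc lines[OF abc(3)] by auto
    then show False using general_positionD(4)[OF L abc] by simp
  qed
qed

text \<open>Bounds the admissible t in \<open>D2\<close> by n; otherwise the condition could hold
  vacuously and \<open>GREATEST\<close> would be unspecified.\<close>

lemma general_position_exists:
  assumes "n \<ge> 3"
  obtains L where "general_position L" "card L = n"
proof -
  \<comment> \<open>Tangents to a parabola.\<close>
  define f where "f i = sheared_line 0 (real i) ((real i)\<^sup>2)" for i :: nat
  have Int: "f i \<inter> f j = {meet 0 (real i) ((real i)\<^sup>2) (real j) ((real j)\<^sup>2)}" if "i \<noteq> j" for i j
    unfolding f_def using that by (intro sheared_line_Int) simp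
  have meet: "meet 0 (real i) ((real i)\<^sup>2) (real j) ((real j)\<^sup>2) = vector [real i + real j, - (real i * real j)]"
    if "i \<noteq> j" for i j
  proof -
    have "((real i)\<^sup>2 - (real j)\<^sup>2) / (real i - real j) = real i + real j"
      using that by (simp add: power2_eq_square square_diff_square_factored)
    then show ?thesis unfolding meet_def Let_def by (simp add: algebra_simps power2_eq_square)
  qed
  have line: "is_line (f i)" for i
    unfolding is_line_iff f_def sheared_line_def by (rule exI[of _ "real i"], rule exI[of _ 1], rule exI[of _ "(real i)\<^sup>2"]) simp
  have conc: "f i \<inter> f j \<inter> f k = {}" if "i \<noteq> j" "i \<noteq> k" "j \<noteq> k" for i j k
  proof -
    have "f i \<inter> f j \<inter> f k = (f i \<inter> f j) \<inter> (f i \<inter> f k)" by blast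
    also have "\<dots> = {}" using that by (simp add: Int meet vec_eq_iff forall_2)
    finally show ?thesis .
  qed
  have inj: "inj f"
  proof (rule injI, rule ccontr)
    fix i j assume "f i = f j" "i \<noteq> j"
    have "(vector [0, (real k)\<^sup>2] :: real^2) \<in> f k" for k
      unfolding f_def sheared_line_def by simp
    then have "(vector [0, (real i)\<^sup>2] :: real^2) \<in> f j" using \<open>f i = f j\<close> by metis
    then show False using \<open>i \<noteq> j\<close> unfolding f_def sheared_line_def by simp
  qed
  have card: "card (f ` {..<n}) = n" using card_image[OF inj_on_subset[OF inj subset_UNIV]] by simp
  have "general_position (f ` {..<n})"
    unfolding general_position_def card
  proof (intro conjI ballI impI)
    fix l m assume "l \<in> f ` {..<n}" "m \<in> f ` {..<n}" "l \<noteq> m"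
    then obtain i j where "l = f i" "m = f j" "i \<noteq> j" by blast
    then show "\<exists>p. l \<inter> m = {p}" using Int by blast
  next
    fix k l m assume "k \<in> f ` {..<n}" "l \<in> f ` {..<n}" "m \<in> f ` {..<n}" "k \<noteq> l \<and> k \<noteq> m \<and> l \<noteq> m"
    then obtain h i j where "k = f h" "l = f i" "m = f j" "h \<noteq> i" "h \<noteq> j" "i \<noteq> j" by blast
    then show "k \<inter> l \<inter> m = {}" using conc by simp
  qed (use assms line in auto)
  then show ?thesis using that card by blast
qed

section \<open>The lower bound for \<open>D2\<close>\<close>

lemma distinct_triangle_areas_subset:
  assumes "distinct_triangle_areas S" "R \<subseteq> S"
  shows "distinct_triangle_areas R"
proof -
  have "{T. T \<subseteq> R \<and> card T = 3} \<subseteq> {T. T \<subseteq> S \<and> card T = 3}" using assms(2) by auto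
  then show ?thesis
    unfolding distinct_triangle_areas_def
    by (rule inj_on_subset[OF assms(1)[unfolded distinct_triangle_areas_def]])
qed

theorem theorem3:
  "\<exists>c::real. c > 0 \<and> (\<forall>\<^sub>F n in sequentially. real (D2 n) \<ge> c * real n powr (1/10))"
proof (intro exI conjI)
  show "(1/3 :: real) > 0" by simp
  show "\<forall>\<^sub>F n in sequentially. real (D2 n) \<ge> 1/3 * real n powr (1/10)"
  proof (rule eventually_sequentiallyI)
    fix n :: nat assume n: "n \<ge> 256"
    define x where "x = 1/3 * real n powr (1/10)"
    have "x \<ge> 0" unfolding x_def by simp
    define t where "t = nat \<lceil>x\<rceil>"
    let ?P = "\<lambda>t. \<forall>L. general_position L \<and> card L = n \<longrightarrow>
             (\<exists>S\<subseteq>L. card S = t \<and> distinct_triangle_areas S)"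
    have "?P t"
    proof (intro allI impI)
      fix L :: "(real^2) set set" assume L: "general_position L \<and> card L = n"
      then have "finite L" "\<And>l. l \<in> L \<Longrightarrow> is_line l" using general_positionD(1,2) by auto
      then obtain s u w where lines: "\<forall>l\<in>L. sheared_line s (u l) (w l) = l" by (rule common_shear)
      interpret planar_points L u w "\<lambda>T. area (triangle T)"
        by (rule planar_points_lines[OF conjunct1[OF L]]) (rule bspec[OF lines])
      obtain S where S: "S \<subseteq> L" "distinct_areas S" "sqrt n \<le> 160 * real (card S) ^ 5"
        using large_distinct_areas n L by auto
      \<comment> \<open>The constant 1/3 is chosen because 3^5 = 243 exceeds 160.\<close>
      have "x ^ 5 = sqrt n / 243"
        unfolding x_def power_mult_distrib using n
        by (simp add: powr_power powr_half_sqrt power_divide)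
      also have "\<dots> \<le> sqrt n / 160" by (intro divide_left_mono) auto
      also have "\<dots> \<le> real (card S) ^ 5" using S(3) by simp
      finally have "x \<le> real (card S)" using power_le_imp_le_base[of x 4 "real (card S)"] by simp
      then have "t \<le> card S" unfolding t_def by (simp add: nat_le_iff ceiling_le_iff)
      \<comment> \<open>\<open>D2\<close> asks for exactly t lines, so \<open>S\<close> is cut
        down.\<close>
      then obtain R where "R \<subseteq> S" "card R = t" by (meson obtain_subset_with_card_n)
      then show "\<exists>R\<subseteq>L. card R = t \<and> distinct_triangle_areas R"
        using S(1,2) distinct_triangle_areas_subset unfolding distinct_areas_def distinct_triangle_areas_def[symmetric]
        by blast
    qed
    moreover have "k \<le> n" if k: "?P k" for k
    proof -
      obtain L where L: "general_position L" "card L = n" using general_position_exists[of n] n by auto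
      then obtain S where "S \<subseteq> L" "card S = k" using k by blast
      then show ?thesis using card_mono[OF general_positionD(1)[OF L(1)], of S] L(2) by simp
    qed
    ultimately have "t \<le> D2 n" unfolding D2_def by (rule Greatest_le_nat)
    then have "real t \<le> real (D2 n)" by simp
    moreover have "x \<le> real t" unfolding t_def using \<open>x \<ge> 0\<close> by linarith
    ultimately show "real (D2 n) \<ge> 1/3 * real n powr (1/10)" unfolding x_def by linarith
  qed
qed

end
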